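(* Let $G$ be a group, $(H,f_G^H)$ a $G$-group and $i\in\{1,2\}$. Write $Spec^i_G(H)=\bigcup_{j\in J}V^i_H(P_j)$, where the $V^i_H(P_j)$, $j\in J$, are the irreducible components of $Spec^i_G(H)$. Suppose that $\bigcap_{j\in J}V^i_H(P_j)$ is not empty. Then $O^i_H(Spec^i_G(H))=H/rad^i_G(H)$; that is, the canonical morphism $H\to O^i_H(Spec^i_G(H))$ sending $h$ to the section $P\mapsto l_P(h)$ induces an isomorphism $H/rad^i_G(H)\to O^i_H(Spec^i_G(H))$.
   Context: A $G$-group is a group $H$ together with a homomorphism $f_G^H:G\to H$. For $x\in H$, $G(x)$ is the subgroup of $H$ generated by $\{f_G^H(g)xf_G^H(g)^{-1}: g\in G\}$. For subgroups $L,L'$, $[L,L']$ is the subgroup generated by the commutators $ll'l^{-1}l'^{-1}$, $l\in L,l'\in L'$. An ideal of $H$ is a normal subgroup distinct from $H$. An ideal $P$ is $T_1$-prime if for all $x,y\in H$, $[G(x),G(y)]\subset P$ implies $x\in P$ or $y\in P$; it is $T_2$-prime if for all $x,y\in H$, $G(x)\cap G(y)\subset P$ implies $x\in P$ or $y\in P$. $Spec^i_G(H)$ is the set of $T_i$-prime ideals of $H$; for a normal subgroup $I$ of $H$, $V^i_H(I)$ is the set of $P\in Spec^i_G(H)$ with $I\subset P$. $Spec^i_G(H)$ carries the topology (the $T_i$-topology) whose closed sets are the sets $V^i_H(I)$, $I$ a normal subgroup of $H$. $rad^i_G(H)$ is the intersection of all elements of $Spec^i_G(H)$. For $P\in Spec^i_G(H)$,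 $l_P:H\to H/P$ is the quotient map. The structural sheaf $O^i_H$: for $U$ open in $Spec^i_G(H)$, $O^i_H(U)$ is the group (under pointwise multiplication) of functions $s:U\to\bigcup_{P\in U}H/P$ such that $s(P)\in H/P$ for every $P\in U$, and such that there exist an open cover $(U_j)_{j}$ of $U$ and elements $h_j\in H$ with $s(P)=l_P(h_j)$ for every $P\in U_j$. *)

theory Defs
  imports "HOL-Algebra.Product_Groups" "HOL-Analysis.Abstract_Topology"
begin

section \<open>\<open>G\<close>-groups and their \<open>T\<^sub>1\<close>- and \<open>T\<^sub>2\<close>-prime ideals\<close>

definition conj_closure ::
  "('g, 'm) monoid_scheme \<Rightarrow> ('h, 'n) monoid_scheme \<Rightarrow> ('g \<Rightarrow> 'h) \<Rightarrow> 'h \<Rightarrow> 'h set"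
  where "conj_closure G H f x =
    generate H {f g \<otimes>\<^bsub>H\<^esub> x \<otimes>\<^bsub>H\<^esub> inv\<^bsub>H\<^esub> (f g) | g. g \<in> carrier G}"

definition commutator_subgroup :: "('h, 'n) monoid_scheme \<Rightarrow> 'h set \<Rightarrow> 'h set \<Rightarrow> 'h set"
  where "commutator_subgroup H L L' =
    generate H {l \<otimes>\<^bsub>H\<^esub> l' \<otimes>\<^bsub>H\<^esub> inv\<^bsub>H\<^esub> l \<otimes>\<^bsub>H\<^esub> inv\<^bsub>H\<^esub> l' | l l'. l \<in> L \<and> l' \<in> L'}"

text \<open>Here an ideal is a \<^emph>\<open>proper\<close> normal subgroup.\<close>

definition group_ideal :: "('h, 'n) monoid_scheme \<Rightarrow> 'h set \<Rightarrow> bool"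
  where "group_ideal H P \<longleftrightarrow> P \<lhd> H \<and> P \<noteq> carrier H"

definition T1_prime ::
  "('g, 'm) monoid_scheme \<Rightarrow> ('h, 'n) monoid_scheme \<Rightarrow> ('g \<Rightarrow> 'h) \<Rightarrow> 'h set \<Rightarrow> bool"
  where "T1_prime G H f P \<longleftrightarrow> group_ideal H P \<and>
    (\<forall>x\<in>carrier H. \<forall>y\<in>carrier H.
       commutator_subgroup H (conj_closure G H f x) (conj_closure G H f y) \<subseteq> P \<longrightarrow>
       x \<in> P \<or> y \<in> P)"

definition T2_prime ::
  "('g, 'm) monoid_scheme \<Rightarrow> ('h, 'n) monoid_scheme \<Rightarrow> ('g \<Rightarrow> 'h) \<Rightarrow> 'h set \<Rightarrow> bool"
  where "T2_prime G H f P \<longleftrightarrow> group_ideal H P \<and>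
    (\<forall>x\<in>carrier H. \<forall>y\<in>carrier H.
       conj_closure G H f x \<inter> conj_closure G H f y \<subseteq> P \<longrightarrow> x \<in> P \<or> y \<in> P)"

text \<open>The index \<open>i\<close> is meant to be \<open>1\<close> or \<open>2\<close>; for any other value the spectrum is empty.\<close>

definition Spec ::
  "nat \<Rightarrow> ('g, 'm) monoid_scheme \<Rightarrow> ('h, 'n) monoid_scheme \<Rightarrow> ('g \<Rightarrow> 'h) \<Rightarrow> 'h set set"
  where "Spec i G H f =
    {P. i = 1 \<and> T1_prime G H f P \<or> i = 2 \<and> T2_prime G H f P}"

definition V ::
  "nat \<Rightarrow> ('g, 'm) monoid_scheme \<Rightarrow> ('h, 'n) monoid_scheme \<Rightarrow> ('g \<Rightarrow> 'h) \<Rightarrow> 'h set \<Rightarrow> 'h set set"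
  where "V i G H f I = {P \<in> Spec i G H f. I \<subseteq> P}"

definition T_topology ::
  "nat \<Rightarrow> ('g, 'm) monoid_scheme \<Rightarrow> ('h, 'n) monoid_scheme \<Rightarrow> ('g \<Rightarrow> 'h) \<Rightarrow> 'h set topology"
  where "T_topology i G H f =
    topology (\<lambda>U. \<exists>I. I \<lhd> H \<and> U = Spec i G H f - V i G H f I)"

text \<open>The intersection with the carrier only matters if there are no primes, in which case
  the radical is the whole group.\<close>

definition rad ::
  "nat \<Rightarrow> ('g, 'm) monoid_scheme \<Rightarrow> ('h, 'n) monoid_scheme \<Rightarrow> ('g \<Rightarrow> 'h) \<Rightarrow> 'h set"
  where "rad i G H f = carrier H \<inter> \<Inter> (Spec i G H f)"


section \<open>Irreducible components\<close>

definition irreducible_space :: "'a topology \<Rightarrow> bool"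
  where "irreducible_space X \<longleftrightarrow> topspace X \<noteq> {} \<and>
    (\<forall>A B. closedin X A \<and> closedin X B \<and> A \<union> B = topspace X \<longrightarrow>
       A = topspace X \<or> B = topspace X)"

definition irreducible_components :: "'a topology \<Rightarrow> 'a set set"
  where "irreducible_components X =
    {S. S \<subseteq> topspace X \<and> irreducible_space (subtopology X S) \<and>
        (\<forall>T. T \<subseteq> topspace X \<and> irreducible_space (subtopology X T) \<and> S \<subseteq> T \<longrightarrow> T = S)}"


section \<open>The structural sheaf\<close>

text \<open>\<open>l\<^sub>P(h)\<close> is the coset \<open>P #>\<^bsub>H\<^esub> h\<close> in \<open>H Mod P\<close>. The group of sections over \<open>U\<close> has the
  operations of the library's direct product of the groups \<open>H Mod P\<close>, \<open>P \<in> U\<close>, whose elements are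
  functions that are \<open>undefined\<close> outside \<open>U\<close>.\<close>

definition sheaf_sections ::
  "nat \<Rightarrow> ('g, 'm) monoid_scheme \<Rightarrow> ('h, 'n) monoid_scheme \<Rightarrow> ('g \<Rightarrow> 'h) \<Rightarrow> 'h set set \<Rightarrow>
   ('h set \<Rightarrow> 'h set) set"
  where "sheaf_sections i G H f U =
    {s \<in> (\<Pi>\<^sub>E P\<in>U. carrier (H Mod P)).
       \<exists>\<U> h. (\<forall>W\<in>\<U>. openin (T_topology i G H f) W) \<and> \<Union>\<U> = U \<and>
             (\<forall>W\<in>\<U>. h W \<in> carrier H \<and> (\<forall>P\<in>W. s P = P #>\<^bsub>H\<^esub> h W))}"

definition structural_sheaf ::
  "nat \<Rightarrow> ('g, 'm) monoid_scheme \<Rightarrow> ('h, 'n) monoid_scheme \<Rightarrow> ('g \<Rightarrow> 'h) \<Rightarrow> 'h set set \<Rightarrow>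
   ('h set \<Rightarrow> 'h set) monoid"
  where "structural_sheaf i G H f U =
    (product_group U (\<lambda>P. H Mod P))\<lparr>carrier := sheaf_sections i G H f U\<rparr>"

definition canonical_section ::
  "nat \<Rightarrow> ('g, 'm) monoid_scheme \<Rightarrow> ('h, 'n) monoid_scheme \<Rightarrow> ('g \<Rightarrow> 'h) \<Rightarrow> 'h \<Rightarrow> 'h set \<Rightarrow> 'h set"
  where "canonical_section i G H f h = (\<lambda>P\<in>Spec i G H f. P #>\<^bsub>H\<^esub> h)"


section \<open>The sets \<open>V(I)\<close> are the closed sets of a topology\<close>

lemma Spec_normal: "P \<in> Spec i G H f \<Longrightarrow> P \<lhd> H"
  by (auto simp: Spec_def T1_prime_def T2_prime_def group_ideal_def)

lemma Spec_proper: "P \<in> Spec i G H f \<Longrightarrow> P \<noteq> carrier H"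
  by (auto simp: Spec_def T1_prime_def T2_prime_def group_ideal_def)

lemma conj_closure_subset:
  assumes "f \<in> hom G H" "I \<lhd> H" "x \<in> I"
  shows "conj_closure G H f x \<subseteq> I"
proof -
  interpret normal I H by fact
  have "f g \<in> carrier H" if "g \<in> carrier G" for g
    using assms(1) that by (auto simp: hom_def)
  then have "{f g \<otimes>\<^bsub>H\<^esub> x \<otimes>\<^bsub>H\<^esub> inv\<^bsub>H\<^esub> (f g) | g. g \<in> carrier G} \<subseteq> I"
    using inv_op_closed2 assms(3) by auto
  then show ?thesis
    unfolding conj_closure_def using generate_subgroup_incl subgroup_axioms by blast
qed

lemma commutator_subgroup_mono:
  assumes "group H" "L \<subseteq> M" "L' \<subseteq> M'"
  shows "commutator_subgroup H L L' \<subseteq> commutator_subgroup H M M'"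
  unfolding commutator_subgroup_def
  by (rule group.mono_generate[OF assms(1)]) (use assms(2,3) in blast)

lemma commutator_subgroup_normal:
  assumes "I \<lhd> H" "K \<lhd> H"
  shows "commutator_subgroup H I K \<lhd> H"
proof -
  interpret I: normal I H by fact
  interpret K: normal K H by fact
  show ?thesis
    unfolding commutator_subgroup_def
  proof (rule I.normal_generateI)
    fix h g assume g: "g \<in> carrier H" and
      "h \<in> {l \<otimes>\<^bsub>H\<^esub> l' \<otimes>\<^bsub>H\<^esub> inv\<^bsub>H\<^esub> l \<otimes>\<^bsub>H\<^esub> inv\<^bsub>H\<^esub> l' | l l'. l \<in> I \<and> l' \<in> K}"
    then obtain l l' where l: "l \<in> I" "l' \<in> K"
      and h: "h = l \<otimes>\<^bsub>H\<^esub> l' \<otimes>\<^bsub>H\<^esub> inv\<^bsub>H\<^esub> l \<otimes>\<^bsub>H\<^esub> inv\<^bsub>H\<^esub> l'" by blast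
    let ?c = "\<lambda>z. g \<otimes>\<^bsub>H\<^esub> z \<otimes>\<^bsub>H\<^esub> inv\<^bsub>H\<^esub> g"
    have c: "l \<in> carrier H" "l' \<in> carrier H" using l by auto
    have k: "inv\<^bsub>H\<^esub> g \<otimes>\<^bsub>H\<^esub> (g \<otimes>\<^bsub>H\<^esub> z) = z" if "z \<in> carrier H" for z
      using that g by (metis I.inv_closed I.l_inv I.l_one I.m_assoc)
    have m: "?c (a \<otimes>\<^bsub>H\<^esub> b) = ?c a \<otimes>\<^bsub>H\<^esub> ?c b" if "a \<in> carrier H" "b \<in> carrier H" for a b
      using that g by (simp add: I.m_assoc k)
    have v: "?c (inv\<^bsub>H\<^esub> a) = inv\<^bsub>H\<^esub> ?c a" if "a \<in> carrier H" for a
      using that g by (simp add: I.inv_mult_group I.m_assoc)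
    have "?c h = ?c l \<otimes>\<^bsub>H\<^esub> ?c l' \<otimes>\<^bsub>H\<^esub> inv\<^bsub>H\<^esub> ?c l \<otimes>\<^bsub>H\<^esub> inv\<^bsub>H\<^esub> ?c l'"
      unfolding h using c by (simp only: m v I.m_closed I.inv_closed)
    moreover have "?c l \<in> I" "?c l' \<in> K"
      using l g I.inv_op_closed2 K.inv_op_closed2 by auto
    ultimately show "?c h \<in> {l \<otimes>\<^bsub>H\<^esub> l' \<otimes>\<^bsub>H\<^esub> inv\<^bsub>H\<^esub> l \<otimes>\<^bsub>H\<^esub> inv\<^bsub>H\<^esub> l' | l l'. l \<in> I \<and> l' \<in> K}"
      by blast
  qed auto
qed

lemma commutator_subgroup_subset:
  assumes "I \<lhd> H" "K \<lhd> H"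
  shows "commutator_subgroup H I K \<subseteq> I \<inter> K"
proof -
  interpret I: normal I H by fact
  interpret K: normal K H by fact
  have "l \<otimes>\<^bsub>H\<^esub> l' \<otimes>\<^bsub>H\<^esub> inv\<^bsub>H\<^esub> l \<otimes>\<^bsub>H\<^esub> inv\<^bsub>H\<^esub> l' \<in> I \<inter> K" if l: "l \<in> I" "l' \<in> K" for l l'
  proof -
    have c: "l \<in> carrier H" "l' \<in> carrier H" using l by auto
    have "l \<otimes>\<^bsub>H\<^esub> (l' \<otimes>\<^bsub>H\<^esub> inv\<^bsub>H\<^esub> l \<otimes>\<^bsub>H\<^esub> inv\<^bsub>H\<^esub> l') \<in> I"
      using l c I.inv_op_closed2 by auto
    moreover have "(l \<otimes>\<^bsub>H\<^esub> l' \<otimes>\<^bsub>H\<^esub> inv\<^bsub>H\<^esub> l) \<otimes>\<^bsub>H\<^esub> inv\<^bsub>H\<^esub> l' \<in> K"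
      using l c K.inv_op_closed2 by auto
    ultimately show ?thesis using c by (simp add: I.m_assoc)
  qed
  then show ?thesis
    unfolding commutator_subgroup_def
    by (intro I.generate_subgroup_incl I.subgroups_Inter_pair I.subgroup_axioms K.subgroup_axioms) auto
qed

lemma group_normal_inter:
  assumes "I \<lhd> H" "K \<lhd> H"
  shows "I \<inter> K \<lhd> H"
proof -
  interpret I: normal I H by fact
  interpret K: normal K H by fact
  show ?thesis
    by (rule I.normal_invI)
      (auto intro: I.subgroups_Inter_pair I.subgroup_axioms K.subgroup_axioms
        I.inv_op_closed2 K.inv_op_closed2)
qed

lemma V_Un:
  assumes f: "f \<in> hom G H" and I: "I \<lhd> H" and K: "K \<lhd> H"
  shows "\<exists>L. L \<lhd> H \<and> V i G H f I \<union> V i G H f K = V i G H f L"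
proof -
  define L where "L = (if i = 1 then commutator_subgroup H I K else I \<inter> K)"
  interpret I: normal I H by fact
  interpret K: normal K H by fact
  have "L \<lhd> H"
    using commutator_subgroup_normal[OF I K] group_normal_inter[OF I K] by (simp add: L_def)
  moreover have "L \<subseteq> I \<inter> K"
    using commutator_subgroup_subset[OF I K] by (simp add: L_def)
  moreover have "I \<subseteq> P \<or> K \<subseteq> P" if P: "P \<in> Spec i G H f" and LP: "L \<subseteq> P" for P
  proof (rule ccontr)
    assume "\<not> ?thesis"
    then obtain x y where xy: "x \<in> I" "x \<notin> P" "y \<in> K" "y \<notin> P" by blast
    note sub = conj_closure_subset[OF f I xy(1)] conj_closure_subset[OF f K xy(3)]
    have c: "x \<in> carrier H" "y \<in> carrier H" using xy by auto
    have "commutator_subgroup H (conj_closure G H f x) (conj_closure G H f y) \<subseteq> P" if "i = 1"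
      using commutator_subgroup_mono[OF I.is_group sub] LP that by (auto simp: L_def)
    moreover have "conj_closure G H f x \<inter> conj_closure G H f y \<subseteq> P" if "i = 2"
      using sub LP that by (auto simp: L_def)
    ultimately show False
      using P c xy unfolding Spec_def T1_prime_def T2_prime_def mem_Collect_eq by meson
  qed
  ultimately have "V i G H f I \<union> V i G H f K = V i G H f L"
    unfolding V_def by blast
  with \<open>L \<lhd> H\<close> show ?thesis by blast
qed

lemma V_Inter:
  assumes "group H" and N: "\<And>I. I \<in> \<I> \<Longrightarrow> I \<lhd> H"
  shows "\<exists>L. L \<lhd> H \<and> {P \<in> Spec i G H f. \<forall>I\<in>\<I>. P \<in> V i G H f I} = V i G H f L"
proof -
  interpret group H by fact
  have sub: "\<Union>\<I> \<subseteq> carrier H"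
  proof (rule Union_least)
    show "I \<subseteq> carrier H" if "I \<in> \<I>" for I
      using normal_imp_subgroup[OF N[OF that]] by (rule subgroup.subset)
  qed
  have "generate H (\<Union>\<I>) \<lhd> H"
  proof (rule normal_generateI[OF sub])
    fix h g assume "h \<in> \<Union>\<I>" and g: "g \<in> carrier H"
    then obtain I where I: "I \<in> \<I>" "h \<in> I" by blast
    from normal.inv_op_closed2[OF N[OF I(1)] g I(2)] I(1)
    show "g \<otimes>\<^bsub>H\<^esub> h \<otimes>\<^bsub>H\<^esub> inv\<^bsub>H\<^esub> g \<in> \<Union>\<I>" by (rule UnionI[rotated])
  qed
  moreover have "generate H (\<Union>\<I>) \<subseteq> P \<longleftrightarrow> (\<forall>I\<in>\<I>. I \<subseteq> P)" if P: "P \<in> Spec i G H f" for P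
  proof
    assume "generate H (\<Union>\<I>) \<subseteq> P"
    moreover have "\<Union>\<I> \<subseteq> generate H (\<Union>\<I>)"
      by (auto intro: generate.incl)
    ultimately show "\<forall>I\<in>\<I>. I \<subseteq> P" by blast
  next
    assume "\<forall>I\<in>\<I>. I \<subseteq> P"
    then have "\<Union>\<I> \<subseteq> P" by blast
    then show "generate H (\<Union>\<I>) \<subseteq> P"
      using generate_subgroup_incl normal_imp_subgroup[OF Spec_normal[OF P]] by simp
  qed
  ultimately show ?thesis
    by (intro exI[of _ "generate H (\<Union>\<I>)"]) (simp add: V_def set_eq_iff; blast)
qed

lemma istopology_T_topology:
  assumes "group H" "f \<in> hom G H"
  shows "istopology (\<lambda>U. \<exists>I. I \<lhd> H \<and> U = Spec i G H f - V i G H f I)" (is "istopology ?O")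
  unfolding istopology_def
proof safe
  fix I K assume "I \<lhd> H" "K \<lhd> H"
  from V_Un[OF assms(2) this, of i] obtain L
    where "L \<lhd> H" "V i G H f I \<union> V i G H f K = V i G H f L" by blast
  then show "?O ((Spec i G H f - V i G H f I) \<inter> (Spec i G H f - V i G H f K))"
    by (intro exI[of _ L]) auto
next
  fix \<K> assume "\<forall>U\<in>\<K>. ?O U"
  then have *: "?O U" if "U \<in> \<K>" for U
    using that by blast
  let ?\<I> = "{I. I \<lhd> H \<and> Spec i G H f - V i G H f I \<in> \<K>}"
  obtain L where L: "L \<lhd> H"
    "{P \<in> Spec i G H f. \<forall>I\<in>?\<I>. P \<in> V i G H f I} = V i G H f L"
    using V_Inter[OF assms(1), of ?\<I> i G f] by blast
  have "\<Union>\<K> = Spec i G H f - V i G H f L"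
    unfolding L(2)[symmetric] using * by (auto; blast)
  with L(1) show "?O (\<Union>\<K>)" by blast
qed

lemma openin_T_topology:
  assumes "group H" "f \<in> hom G H"
  shows "openin (T_topology i G H f) U \<longleftrightarrow>
    (\<exists>I. I \<lhd> H \<and> U = Spec i G H f - V i G H f I)"
  using istopology_T_topology[OF assms, of i] by (simp add: T_topology_def)

lemma topspace_T_topology:
  assumes "group H" "f \<in> hom G H"
  shows "topspace (T_topology i G H f) = Spec i G H f"
proof -
  have "V i G H f (carrier H) = {}"
    using Spec_normal Spec_proper normal_imp_subgroup subgroup.subset
    by (fastforce simp: V_def)
  moreover have "carrier H \<lhd> H"
    using assms(1) by (simp add: group.normal_self)
  ultimately have "openin (T_topology i G H f) (Spec i G H f)"
    unfolding openin_T_topology[OF assms] by blast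
  moreover have "topspace (T_topology i G H f) \<subseteq> Spec i G H f"
    using openin_topspace[of "T_topology i G H f"] unfolding openin_T_topology[OF assms] by blast
  ultimately show ?thesis
    using openin_subset by blast
qed

lemma closedin_T_topology:
  assumes "group H" "f \<in> hom G H"
  shows "closedin (T_topology i G H f) C \<longleftrightarrow> (\<exists>I. I \<lhd> H \<and> C = V i G H f I)"
  unfolding closedin_def topspace_T_topology[OF assms] openin_T_topology[OF assms]
  by (auto simp: V_def)

end

theory Submission
  imports Defs
begin

text \<open>The canonical map \<open>H \<rightarrow> \<Prod>P. H Mod P\<close> is a homomorphism whose kernel is the intersection
  of all primes, i.e. the radical. By the first isomorphism theorem everything thus reduces to the
  claim that every global section \<open>s\<close> is the canonical section of a single element of \<open>H\<close>.

  Choose a prime \<open>Q\<close> that lies in all irreducible components and let \<open>h\<^sub>0\<close> represent \<open>s\<close> on an open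
  neighbourhood \<open>W\<^sub>0\<close> of \<open>Q\<close>. Given any prime \<open>P\<close>, let \<open>h\<^sub>1\<close> represent \<open>s\<close> on an open
  neighbourhood \<open>W\<^sub>1\<close> of \<open>P\<close>, and let \<open>S\<close> be an irreducible component through \<open>P\<close>, which exists by
  Zorn's lemma and which also contains \<open>Q\<close>. On \<open>W\<^sub>0 \<inter> W\<^sub>1\<close> the two elements represent the same
  cosets, so \<open>h\<^sub>1 h\<^sub>0\<^sup>-\<^sup>1\<close> belongs to every prime there. The primes containing a given element form a
  closed set (lemma \<open>closedin_primes_containing\<close>), hence \<open>S\<close> is covered by three closed sets: the
  complement of \<open>W\<^sub>0\<close>, the complement of \<open>W\<^sub>1\<close>, and the primes containing \<open>h\<^sub>1 h\<^sub>0\<^sup>-\<^sup>1\<close>. By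
  irreducibility one of them contains \<open>S\<close>; it is not the first because of \<open>Q\<close>, nor the second
  because of \<open>P\<close>. So \<open>h\<^sub>1 h\<^sub>0\<^sup>-\<^sup>1 \<in> P\<close>, and \<open>h\<^sub>0\<close> represents \<open>s\<close> at \<open>P\<close> as well.\<close>


section \<open>Irreducible components of a topological space\<close>

text \<open>Stated with closed sets of the ambient space, irreducibility of a subset can be used and
  proved without passing to the subspace topology.\<close>

lemma irreducible_subtopology_iff:
  assumes "S \<subseteq> topspace X"
  shows "irreducible_space (subtopology X S) \<longleftrightarrow> S \<noteq> {} \<and>
    (\<forall>A B. closedin X A \<and> closedin X B \<and> S \<subseteq> A \<union> B \<longrightarrow> S \<subseteq> A \<or> S \<subseteq> B)"
    (is "?lhs \<longleftrightarrow> S \<noteq> {} \<and> ?rhs")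
proof -
  have top: "topspace (subtopology X S) = S"
    using assms by (rule topspace_subtopology_subset)
  show ?thesis
  proof (intro iffI conjI allI impI; (elim conjE)?)
    assume L: ?lhs
    then show "S \<noteq> {}" unfolding irreducible_space_def top by blast
    fix A B assume AB: "closedin X A" "closedin X B" "S \<subseteq> A \<union> B"
    have "closedin (subtopology X S) (A \<inter> S)" "closedin (subtopology X S) (B \<inter> S)"
      using AB by (auto simp: closedin_subtopology)
    moreover have "A \<inter> S \<union> B \<inter> S = S" using AB by blast
    ultimately have "A \<inter> S = S \<or> B \<inter> S = S"
      using L unfolding irreducible_space_def top by blast
    then show "S \<subseteq> A \<or> S \<subseteq> B" by blast
  next
    assume ne: "S \<noteq> {}" and R: ?rhs
    show ?lhs
      unfolding irreducible_space_def top
    proof (intro conjI allI impI ne; elim conjE)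
      fix A B assume AB: "closedin (subtopology X S) A" "closedin (subtopology X S) B" "A \<union> B = S"
      then obtain A' B' where "closedin X A'" "A = A' \<inter> S" "closedin X B'" "B = B' \<inter> S"
        unfolding closedin_subtopology by blast
      with R AB(3) show "A = S \<or> B = S" by blast
    qed
  qed
qed

lemma irreducible_Union_chain:
  assumes chain: "\<And>S T. S \<in> \<C> \<Longrightarrow> T \<in> \<C> \<Longrightarrow> S \<subseteq> T \<or> T \<subseteq> S" and "\<C> \<noteq> {}"
    and irr: "\<And>S. S \<in> \<C> \<Longrightarrow> S \<subseteq> topspace X \<and> irreducible_space (subtopology X S)"
  shows "irreducible_space (subtopology X (\<Union>\<C>))"
proof -
  have irr': "S \<noteq> {} \<and>
      (\<forall>A B. closedin X A \<and> closedin X B \<and> S \<subseteq> A \<union> B \<longrightarrow> S \<subseteq> A \<or> S \<subseteq> B)" if "S \<in> \<C>" for S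
    using irr[OF that] irreducible_subtopology_iff by blast
  have sub: "\<Union>\<C> \<subseteq> topspace X" using irr by blast
  show ?thesis
    unfolding irreducible_subtopology_iff[OF sub]
  proof (intro conjI allI impI; (elim conjE)?)
    show "\<Union>\<C> \<noteq> {}" using irr' \<open>\<C> \<noteq> {}\<close> by blast
    fix A B assume AB: "closedin X A" "closedin X B" "\<Union>\<C> \<subseteq> A \<union> B"
    show "\<Union>\<C> \<subseteq> A \<or> \<Union>\<C> \<subseteq> B"
    proof (rule ccontr)
      assume "\<not> ?thesis"
      then obtain S T where ST: "S \<in> \<C>" "\<not> S \<subseteq> A" "T \<in> \<C>" "\<not> T \<subseteq> B" by blast
      \<comment> \<open>The larger of the two lies neither in \<open>A\<close> nor in \<open>B\<close>.\<close>
      then obtain U where "U \<in> \<C>" "\<not> U \<subseteq> A" "\<not> U \<subseteq> B"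
        using chain[of S T] by blast
      with irr'[of U] AB show False by blast
    qed
  qed
qed

text \<open>Zorn's lemma, applied to the irreducible subsets through \<open>x\<close>, which include \<open>{x}\<close>.\<close>

lemma irreducible_component_through:
  assumes "x \<in> topspace X"
  obtains S where "S \<in> irreducible_components X" "x \<in> S"
proof -
  define \<A> where "\<A> = {S. x \<in> S \<and> S \<subseteq> topspace X \<and> irreducible_space (subtopology X S)}"
  have "{x} \<in> \<A>"
    using assms by (auto simp: \<A>_def irreducible_subtopology_iff)
  have "\<exists>M\<in>\<A>. \<forall>T\<in>\<A>. M \<subseteq> T \<longrightarrow> T = M"
  proof (rule subset_Zorn_nonempty)
    show "\<A> \<noteq> {}" using \<open>{x} \<in> \<A>\<close> by blast
    fix \<C> assume \<C>: "\<C> \<noteq> {}" "subset.chain \<A> \<C>"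
    then have sub: "\<C> \<subseteq> \<A>" and "\<And>S T. S \<in> \<C> \<Longrightarrow> T \<in> \<C> \<Longrightarrow> S \<subseteq> T \<or> T \<subseteq> S"
      by (auto simp: subset_chain_def)
    then have "irreducible_space (subtopology X (\<Union>\<C>))"
      using \<C>(1) by (intro irreducible_Union_chain) (auto simp: \<A>_def)
    then show "\<Union>\<C> \<in> \<A>" using sub \<C>(1) by (auto simp: \<A>_def)
  qed
  then obtain M where M: "M \<in> \<A>" "\<And>T. T \<in> \<A> \<Longrightarrow> M \<subseteq> T \<Longrightarrow> T = M" by blast
  have "M \<in> irreducible_components X"
    using M unfolding irreducible_components_def \<A>_def by blast
  moreover have "x \<in> M" using M(1) by (simp add: \<A>_def)
  ultimately show thesis by (rule that)
qed


section \<open>The canonical homomorphism\<close>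

text \<open>The closed set in question is \<open>V(N)\<close> for \<open>N\<close> the normal closure of \<open>x\<close>, since primes are
  normal.\<close>

lemma closedin_primes_containing:
  assumes H: "group H" and f: "f \<in> hom G H" and x: "x \<in> carrier H"
  shows "closedin (T_topology i G H f) {P \<in> Spec i G H f. x \<in> P}"
proof -
  interpret group H by fact
  define N where "N = \<Inter>{K. K \<lhd> H \<and> x \<in> K}"
  have carr: "carrier H \<in> {K. K \<lhd> H \<and> x \<in> K}"
    using x normal_self by simp
  have "N \<lhd> H"
  proof (rule normal_invI)
    show "subgroup N H"
      unfolding N_def using carr by (intro subgroups_Inter) (auto intro: normal_imp_subgroup)
    show "y \<otimes>\<^bsub>H\<^esub> h \<otimes>\<^bsub>H\<^esub> inv\<^bsub>H\<^esub> y \<in> N" if "y \<in> carrier H" "h \<in> N" for y h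
      using that normal.inv_op_closed2 unfolding N_def by fastforce
  qed
  moreover have "{P \<in> Spec i G H f. x \<in> P} = V i G H f N"
    using Spec_normal[of _ i G H f] unfolding V_def N_def by blast
  ultimately show ?thesis
    unfolding closedin_T_topology[OF H f] by blast
qed

lemma group_hom_canonical_section:
  assumes "group H"
  shows "group_hom H (product_group (Spec i G H f) (\<lambda>P. H Mod P)) (canonical_section i G H f)"
proof -
  have "canonical_section i G H f \<in> hom H (product_group (Spec i G H f) (\<lambda>P. H Mod P))"
  proof (rule homI)
    fix h k assume "h \<in> carrier H" "k \<in> carrier H"
    then show "canonical_section i G H f (h \<otimes>\<^bsub>H\<^esub> k) =
        canonical_section i G H f h \<otimes>\<^bsub>product_group (Spec i G H f) (\<lambda>P. H Mod P)\<^esub>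
        canonical_section i G H f k"
      by (auto simp: canonical_section_def normal.rcos_sum[OF Spec_normal] intro!: restrict_ext)
  qed (auto simp: canonical_section_def carrier_FactGroup)
  moreover have "group (product_group (Spec i G H f) (\<lambda>P. H Mod P))"
    by (intro product_group normal.factorgroup_is_group Spec_normal)
  ultimately show ?thesis
    using assms by (simp add: group_hom_def group_hom_axioms_def)
qed

text \<open>The coset of \<open>h\<close> modulo \<open>P\<close> is trivial exactly if \<open>h \<in> P\<close>.\<close>

lemma kernel_canonical_section:
  assumes "group H"
  shows "kernel H (product_group (Spec i G H f) (\<lambda>P. H Mod P)) (canonical_section i G H f) =
    rad i G H f"
proof -
  interpret group H by fact
  have "P #>\<^bsub>H\<^esub> h = P \<longleftrightarrow> h \<in> P" if "P \<in> Spec i G H f" "h \<in> carrier H" for P h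
    using that coset_join1 coset_join2 normal_imp_subgroup[OF Spec_normal[OF that(1)]]
      subgroup.subset by metis
  then show ?thesis
    by (auto simp: kernel_def rad_def canonical_section_def fun_eq_iff restrict_def)
qed

lemma canonical_section_in_sections:
  assumes H: "group H" and f: "f \<in> hom G H" and h: "h \<in> carrier H"
  shows "canonical_section i G H f h \<in> sheaf_sections i G H f (Spec i G H f)"
proof -
  have "openin (T_topology i G H f) (Spec i G H f)"
    using openin_topspace[of "T_topology i G H f"] by (simp add: topspace_T_topology[OF H f])
  then show ?thesis
    unfolding sheaf_sections_def using h
    by (auto simp: canonical_section_def carrier_FactGroup
        intro!: exI[of _ "{Spec i G H f}"] exI[of _ "\<lambda>_. h"])
qed


section \<open>Global sections\<close>

text \<open>Any local representative of \<open>s\<close> at \<open>Q\<close> is a global one: its agreement with \<open>s\<close> spreads from a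
  neighbourhood of \<open>Q\<close> along every irreducible component, because each of them passes through \<open>Q\<close>.\<close>

lemma section_eq_canonical_section:
  assumes H: "group H" and f: "f \<in> hom G H"
    and Q: "Q \<in> Spec i G H f" "\<And>S. S \<in> irreducible_components (T_topology i G H f) \<Longrightarrow> Q \<in> S"
    and s: "s \<in> sheaf_sections i G H f (Spec i G H f)"
  obtains h where "h \<in> carrier H" "s = canonical_section i G H f h"
proof -
  interpret group H by fact
  let ?X = "T_topology i G H f"
  note top = topspace_T_topology[OF H f, of i]
  from s have "\<exists>\<U> h. (\<forall>W\<in>\<U>. openin ?X W) \<and> \<Union>\<U> = Spec i G H f \<and>
      (\<forall>W\<in>\<U>. h W \<in> carrier H \<and> (\<forall>P\<in>W. s P = P #>\<^bsub>H\<^esub> h W))"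
    by (simp add: sheaf_sections_def)
  then obtain \<U> h where cover: "\<forall>W\<in>\<U>. openin ?X W" and \<U>: "\<Union>\<U> = Spec i G H f"
    and local: "\<forall>W\<in>\<U>. h W \<in> carrier H \<and> (\<forall>P\<in>W. s P = P #>\<^bsub>H\<^esub> h W)"
    by (elim exE conjE)
  have h: "h W \<in> carrier H" if "W \<in> \<U>" for W
    using local that by blast
  have sh: "s P = P #>\<^bsub>H\<^esub> h W" if "W \<in> \<U>" "P \<in> W" for W P
    using local that by blast
  obtain W0 where W0: "W0 \<in> \<U>" "Q \<in> W0" using Q(1) \<U> by blast
  have glob: "s P = P #>\<^bsub>H\<^esub> h W0" if P: "P \<in> Spec i G H f" for P
  proof -
    obtain W1 where W1: "W1 \<in> \<U>" "P \<in> W1" using P \<U> by blast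
    obtain S where S: "S \<in> irreducible_components ?X" "P \<in> S"
      using irreducible_component_through[of P ?X] P top by blast
    define c where "c = h W1 \<otimes>\<^bsub>H\<^esub> inv\<^bsub>H\<^esub> h W0"
    have c: "c \<in> carrier H" using h W0 W1 by (simp add: c_def)
    have c_iff: "c \<in> R \<longleftrightarrow> R #>\<^bsub>H\<^esub> h W1 = R #>\<^bsub>H\<^esub> h W0" if "R \<in> Spec i G H f" for R
    proof -
      interpret R: normal R H using that by (rule Spec_normal)
      have "c \<in> R \<longleftrightarrow> h W1 \<in> R #>\<^bsub>H\<^esub> h W0"
        unfolding c_def using R.rcos_module[OF H] h W0(1) W1(1) by blast
      also have "\<dots> \<longleftrightarrow> R #>\<^bsub>H\<^esub> h W1 = R #>\<^bsub>H\<^esub> h W0"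
        using repr_independence[OF _ h[OF W0(1)] R.subgroup_axioms]
          rcos_self[OF h[OF W1(1)] R.subgroup_axioms] by metis
      finally show ?thesis .
    qed
    let ?C = "{R \<in> Spec i G H f. c \<in> R}"
    have S_sub: "S \<subseteq> topspace ?X" and "irreducible_space (subtopology ?X S)"
      using S(1) by (auto simp: irreducible_components_def)
    then have irr: "S \<subseteq> A \<or> S \<subseteq> B" if "closedin ?X A" "closedin ?X B" "S \<subseteq> A \<union> B" for A B
      using that irreducible_subtopology_iff[OF S_sub] by blast
    have cl: "closedin ?X (topspace ?X - W0)" "closedin ?X (topspace ?X - W1)" "closedin ?X ?C"
      using cover W0 W1 closedin_primes_containing[OF H f c] by auto
    have "R \<in> ?C" if "R \<in> W0" "R \<in> W1" for R
    proof -
      have "R \<in> Spec i G H f" using that(1) W0(1) \<U> by blast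
      moreover have "R #>\<^bsub>H\<^esub> h W1 = R #>\<^bsub>H\<^esub> h W0"
        using sh[OF W0(1) that(1)] sh[OF W1(1) that(2)] by simp
      ultimately show ?thesis using c_iff by blast
    qed
    \<comment> \<open>Irreducibility is applied twice, as a cover by three closed sets has to be reduced to one.\<close>
    then have "S \<subseteq> (topspace ?X - W0) \<union> ((topspace ?X - W1) \<union> ?C)"
      using S_sub by blast
    moreover have "\<not> S \<subseteq> topspace ?X - W0" "\<not> S \<subseteq> topspace ?X - W1"
      using Q(2)[OF S(1)] W0(2) S(2) W1(2) by auto
    ultimately have "S \<subseteq> ?C"
      using irr[OF cl(1) closedin_Un[OF cl(2,3)]] irr[OF cl(2,3)] by blast
    then have "c \<in> P" using S(2) by blast
    then show ?thesis
      using c_iff[OF P] sh[OF W1] by simp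
  qed
  have "s = canonical_section i G H f (h W0)"
  proof (rule extensionalityI)
    show "s \<in> extensional (Spec i G H f)"
      using s by (auto simp: sheaf_sections_def PiE_def)
  qed (use glob in \<open>auto simp: canonical_section_def\<close>)
  with h[OF W0(1)] show thesis by (rule that)
qed

theorem theorem4p1:
  fixes G :: "('g, 'm) monoid_scheme" and H :: "('h, 'n) monoid_scheme"
    and f :: "'g \<Rightarrow> 'h" and i :: nat and J :: "'j set" and P :: "'j \<Rightarrow> 'h set"
  assumes "group G" and "group H" and "f \<in> hom G H" and "i \<in> {1, 2}"
    and "\<And>j. j \<in> J \<Longrightarrow> P j \<lhd> H"
    and "(\<lambda>j. V i G H f (P j)) ` J = irreducible_components (T_topology i G H f)"
    and "Spec i G H f \<inter> (\<Inter>j\<in>J. V i G H f (P j)) \<noteq> {}"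
  shows "canonical_section i G H f \<in> hom H (structural_sheaf i G H f (Spec i G H f)) \<and>
    (\<exists>\<phi> \<in> iso (H Mod rad i G H f) (structural_sheaf i G H f (Spec i G H f)).
       \<forall>h\<in>carrier H. \<phi> (rad i G H f #>\<^bsub>H\<^esub> h) = canonical_section i G H f h)"
proof -
  let ?S = "Spec i G H f" and ?s = "canonical_section i G H f" and ?R = "rad i G H f"
  let ?\<Pi> = "product_group ?S (\<lambda>P. H Mod P)" and ?O = "structural_sheaf i G H f ?S"
  note H = \<open>group H\<close> and f = \<open>f \<in> hom G H\<close>
  interpret \<Pi>: group_hom H ?\<Pi> ?s
    using H by (rule group_hom_canonical_section)
  obtain Q where Q: "Q \<in> ?S" "\<And>j. j \<in> J \<Longrightarrow> Q \<in> V i G H f (P j)"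
    using assms(7) by blast
  then have comp: "Q \<in> S" if "S \<in> irreducible_components (T_topology i G H f)" for S
    using that unfolding assms(6)[symmetric] by blast
  have img: "?s ` carrier H = sheaf_sections i G H f ?S"
  proof
    show "?s ` carrier H \<subseteq> sheaf_sections i G H f ?S"
      using canonical_section_in_sections[OF H f] by blast
    show "sheaf_sections i G H f ?S \<subseteq> ?s ` carrier H"
      using section_eq_canonical_section[OF H f Q(1) comp] by (metis image_eqI subsetI)
  qed
  then have O: "?O = ?\<Pi>\<lparr>carrier := ?s ` carrier H\<rparr>"
    by (simp add: structural_sheaf_def)
  \<comment> \<open>As the image of a homomorphism, the global sections form a subgroup of the product.\<close>
  have "group ?O"
    unfolding O by (rule \<Pi>.H.subgroup_imp_group[OF \<Pi>.img_is_subgroup])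
  moreover have hom: "?s \<in> hom H ?O"
    unfolding O using \<Pi>.homh by (auto simp: hom_def)
  ultimately interpret O: group_hom H ?O ?s
    using H by (simp add: group_hom_def group_hom_axioms_def)
  have ker: "kernel H ?O ?s = ?R"
    using kernel_canonical_section[OF H, of i G f] by (simp add: O kernel_def)
  have iso: "(\<lambda>X. the_elem (?s ` X)) \<in> iso (H Mod ?R) ?O"
    using O.FactGroup_iso_set by (simp add: ker) (simp add: O)
  have elem: "the_elem (?s ` (?R #>\<^bsub>H\<^esub> h)) = ?s h" if h: "h \<in> carrier H" for h
  proof -
    have const: "?s x = ?s h" if "x \<in> ?R #>\<^bsub>H\<^esub> h" for x
    proof -
      obtain k where "k \<in> ?R" and x: "x = k \<otimes>\<^bsub>H\<^esub> h"
        using \<open>x \<in> ?R #>\<^bsub>H\<^esub> h\<close> by (auto simp: r_coset_def)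
      then have k: "k \<in> carrier H" "?s k = \<one>\<^bsub>?O\<^esub>"
        by (simp_all only: ker[symmetric] kernel_def mem_Collect_eq)
      have "?s x = ?s k \<otimes>\<^bsub>?O\<^esub> ?s h"
        unfolding x using k(1) h by (rule O.hom_mult)
      also have "\<dots> = ?s h"
        unfolding k(2) using O.hom_closed[OF h] by (rule O.H.l_one)
      finally show ?thesis .
    qed
    have "h \<in> ?R #>\<^bsub>H\<^esub> h"
      using group.rcos_self[OF H h] O.subgroup_kernel by (simp add: ker)
    then have "?R #>\<^bsub>H\<^esub> h \<noteq> {}" by blast
    then show ?thesis
      by (rule the_elem_image_unique[OF _ const])
  qed
  show ?thesis
    by (intro conjI bexI[OF _ iso] ballI hom elem)
qed

end
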